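(* Let $G$ be a finite group, and let $\mathcal{SC}(G)=\{H\leq G \mid C_G(H)\leq H\}$ be the set of all self-centralizing subgroups of $G$. Let $C_{\mathcal{SC}}(G)=\bigcap_{H\in\mathcal{SC}(G)}H$ be the intersection of all subgroups in $\mathcal{SC}(G)$. Then $Z(G)=C_{\mathcal{SC}}(G)$.
   Context: All groups are finite. $C_G(H)$ denotes the centralizer of $H$ in $G$ and $Z(G)$ the center of $G$. A subgroup $H$ of $G$ is called self-centralizing if $C_G(H)\leq H$ (equality is not required). *)

theory Defs
  imports "HOL-Algebra.Group"
begin

definition group_centralizer :: "('a, 'b) monoid_scheme \<Rightarrow> 'a set \<Rightarrow> 'a set" where
  "group_centralizer G H =
    {x \<in> carrier G. \<forall>h\<in>H. x \<otimes>\<^bsub>G\<^esub> h = h \<otimes>\<^bsub>G\<^esub> x}"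

definition group_center :: "('a, 'b) monoid_scheme \<Rightarrow> 'a set" where
  "group_center G =
    {x \<in> carrier G. \<forall>g\<in>carrier G. x \<otimes>\<^bsub>G\<^esub> g = g \<otimes>\<^bsub>G\<^esub> x}"

definition self_centralizing_subgroups :: "('a, 'b) monoid_scheme \<Rightarrow> 'a set set" where
  "self_centralizing_subgroups G = {H. subgroup H G \<and> group_centralizer G H \<subseteq> H}"

(* The family is never empty, as it contains carrier G, so the intersection
   is a subset of carrier G. *)
definition self_centralizing_core :: "('a, 'b) monoid_scheme \<Rightarrow> 'a set" where
  "self_centralizing_core G = \<Inter> (self_centralizing_subgroups G)"

end

(* A maximal set S of pairwise commuting elements satisfies C_G(S) = S, so it is a
   self-centralizing abelian subgroup. Every g lies in such an S, and S contains the
   intersection of all self-centralizing subgroups; so every element of that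
   intersection commutes with every g. *)
theory Submission
  imports Defs
begin

lemma subgroup_group_centralizer:
  assumes "group G" and "S \<subseteq> carrier G"
  shows "subgroup (group_centralizer G S) G"
proof -
  interpret group G by fact
  show ?thesis
  proof (rule subgroupI)
    show "group_centralizer G S \<subseteq> carrier G"
      by (auto simp: group_centralizer_def)
    have "\<one>\<^bsub>G\<^esub> \<in> group_centralizer G S"
      using assms(2) by (auto simp: group_centralizer_def)
    then show "group_centralizer G S \<noteq> {}"
      by blast
  next
    fix a assume "a \<in> group_centralizer G S"
    then have a: "a \<in> carrier G" "\<And>h. h \<in> S \<Longrightarrow> a \<otimes>\<^bsub>G\<^esub> h = h \<otimes>\<^bsub>G\<^esub> a"
      by (auto simp: group_centralizer_def)
    have "inv\<^bsub>G\<^esub> a \<otimes>\<^bsub>G\<^esub> h = h \<otimes>\<^bsub>G\<^esub> inv\<^bsub>G\<^esub> a" if "h \<in> S" for h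
    proof -
      have h: "h \<in> carrier G" using that assms(2) by blast
      show ?thesis
        \<comment> \<open>Clearing the left inverse turns the claim into
          \<open>h = a (h inv a)\<close>; clearing the right one then leaves
          \<open>a h = h a\<close>, which is given.\<close>
        using a h that inv_solve_left'[of "h \<otimes>\<^bsub>G\<^esub> inv\<^bsub>G\<^esub> a" a h] inv_solve_right'[of h "a \<otimes>\<^bsub>G\<^esub> h" a] m_assoc[of a h "inv\<^bsub>G\<^esub> a"] by simp
    qed
    then show "inv\<^bsub>G\<^esub> a \<in> group_centralizer G S"
      using a(1) by (auto simp: group_centralizer_def)
  next
    fix a b assume ab: "a \<in> group_centralizer G S" "b \<in> group_centralizer G S"
    have "a \<otimes>\<^bsub>G\<^esub> b \<otimes>\<^bsub>G\<^esub> h = h \<otimes>\<^bsub>G\<^esub> (a \<otimes>\<^bsub>G\<^esub> b)" if "h \<in> S" for h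
    proof -
      have c: "a \<in> carrier G" "b \<in> carrier G" "h \<in> carrier G"
        and e: "a \<otimes>\<^bsub>G\<^esub> h = h \<otimes>\<^bsub>G\<^esub> a" "b \<otimes>\<^bsub>G\<^esub> h = h \<otimes>\<^bsub>G\<^esub> b"
        using ab that assms(2) by (auto simp: group_centralizer_def)
      have "a \<otimes>\<^bsub>G\<^esub> b \<otimes>\<^bsub>G\<^esub> h = a \<otimes>\<^bsub>G\<^esub> h \<otimes>\<^bsub>G\<^esub> b"
        using c e(2) by (simp add: m_assoc)
      then show ?thesis
        using c e(1) by (simp add: m_assoc)
    qed
    then show "a \<otimes>\<^bsub>G\<^esub> b \<in> group_centralizer G S"
      using ab by (auto simp: group_centralizer_def)
  qed
qed

text \<open>An element centralizing a commuting set can be adjoined to it and the set still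
  commutes, so a maximal commuting set absorbs its whole centralizer.\<close>

lemma ex_group_centralizer_eq_self:
  assumes "finite (carrier G)" and "g \<in> carrier G"
  shows "\<exists>S \<subseteq> carrier G. g \<in> S \<and> group_centralizer G S = S"
proof -
  \<comment> \<open>Membership in \<open>?F\<close> encodes pairwise commutation. Plain subsets
    suffice, so enlarging \<open>S\<close> by one element requires no generated subgroup.\<close>
  let ?F = "{S \<in> Pow (carrier G). S \<subseteq> group_centralizer G S}"
  have "finite ?F" and "{g} \<in> ?F"
    using assms by (auto simp: group_centralizer_def)
  from finite_has_maximal2[OF this] obtain S
    where S: "S \<in> ?F" "{g} \<subseteq> S"
      and maximal: "\<forall>T\<in>?F. S \<subseteq> T \<longrightarrow> S = T"
    by (elim bexE conjE)
  have "y \<in> S" if "y \<in> group_centralizer G S" for y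
  proof -
    have comm: "u \<otimes>\<^bsub>G\<^esub> v = v \<otimes>\<^bsub>G\<^esub> u" if "u \<in> S" "v \<in> S" for u v
      using S(1) that unfolding group_centralizer_def by blast
    have y: "y \<in> carrier G" "\<And>v. v \<in> S \<Longrightarrow> y \<otimes>\<^bsub>G\<^esub> v = v \<otimes>\<^bsub>G\<^esub> y"
      using that unfolding group_centralizer_def by blast+
    \<comment> \<open>The only new pairs involve \<open>y\<close>, which commutes with itself and,
      by its choice, with all of \<open>S\<close>.\<close>
    have "u \<otimes>\<^bsub>G\<^esub> v = v \<otimes>\<^bsub>G\<^esub> u" if "u \<in> insert y S" "v \<in> insert y S" for u v
      using that comm y(2) by (metis insertE)
    then have "insert y S \<in> ?F"
      using S(1) y(1) unfolding group_centralizer_def by blast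
    then show ?thesis
      using bspec[OF maximal, of "insert y S"] by blast
  qed
  then show ?thesis
    using S by blast
qed

theorem theorem1p2:
  fixes G (structure)
  assumes "group G" and "finite (carrier G)"
  shows "group_center G = self_centralizing_core G"
proof
  \<comment> \<open>Central elements centralize every subgroup, and a self-centralizing one contains
    its centralizer.\<close>
  have "group_center G \<subseteq> group_centralizer G H" if "subgroup H G" for H
    using subgroup.subset[OF that] by (auto simp: group_center_def group_centralizer_def)
  then show "group_center G \<subseteq> self_centralizing_core G"
    by (auto simp: self_centralizing_core_def self_centralizing_subgroups_def)
next
  have "x \<in> carrier G \<and> x \<otimes> g = g \<otimes> x"
    if x: "x \<in> self_centralizing_core G" and g: "g \<in> carrier G" for x g
  proof -
    obtain S where S: "S \<subseteq> carrier G" "g \<in> S" "group_centralizer G S = S"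
      using ex_group_centralizer_eq_self[OF assms(2) g] by blast
    \<comment> \<open>\<open>S\<close> was obtained only as a set; it is a subgroup because it
      equals a centralizer.\<close>
    have "S \<in> self_centralizing_subgroups G"
      using subgroup_group_centralizer[OF assms(1) S(1)] S(3)
      by (simp add: self_centralizing_subgroups_def)
    \<comment> \<open>The core lies inside \<open>S\<close>, and reading \<open>S\<close> as its own
      centralizer makes \<open>x\<close> commute with \<open>g\<close>.\<close>
    then have "x \<in> group_centralizer G S"
      using x S(3) by (auto simp: self_centralizing_core_def)
    then show ?thesis
      using S(2) by (auto simp: group_centralizer_def)
  qed
  \<comment> \<open>That \<open>x\<close> lies in the carrier was derived from a given
    \<open>g\<close>; \<open>\<one>\<close> provides such a \<open>g\<close>.\<close>
  moreover have "\<one> \<in> carrier G"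
    using assms(1) by (simp add: group.is_monoid)
  ultimately show "self_centralizing_core G \<subseteq> group_center G"
    by (auto simp: group_center_def)
qed

end
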